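(* Let $f(z)$, $z=(z_1,\ldots,z_d)\in\mathbb{C}^d$, be a rational function with real coefficients. Then there exist a positive integer $M$ and real symmetric $M\times M$ matrices $A_0,A_1,\ldots,A_d$ (that is, $\overline{A}_j=A_j=A_j^T$ for $j=0,1,\ldots,d$) such that, writing the matrix pencil in block form $$A_0+z_1A_1+\cdots+z_dA_d=\begin{pmatrix}A_{11}(z)&A_{12}(z)\\ A_{21}(z)&A_{22}(z)\end{pmatrix},$$ where the block $A_{11}(z)$ is of size $1\times 1$ and $\det A_{22}(z)\not\equiv 0$, one has $$f(z)=A_{11}(z)-A_{12}(z)A_{22}(z)^{-1}A_{21}(z)$$ as an identity of rational functions. *)

theory Defs
  imports
    "HOL-Library.Poly_Mapping"
    "HOL-Computational_Algebra.Fraction_Field"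
    "Jordan_Normal_Form.Matrix"
    "Jordan_Normal_Form.Determinant"
    "Jordan_Normal_Form.Gauss_Jordan_Elimination"
begin

text \<open>
  A monomial is a finitely supported map from variable indices to exponents, and a polynomial is a
  finitely supported map from monomials to real coefficients; both are unrestricted in the number
  of variables. The restriction to the variables \<open>z\<^sub>1, \<dots>, z\<^sub>d\<close> is made by
  \<open>polynomials\<close> and \<open>rational_functions\<close> below, so that \<open>d\<close> remains an ordinary natural number.
  Rational functions are formal fractions: equality in \<open>rfun\<close> is identity of rational functions.
\<close>

type_synonym mpoly = "(nat \<Rightarrow>\<^sub>0 nat) \<Rightarrow>\<^sub>0 real"
type_synonym rfun = "mpoly fract"

definition polynomials :: "nat \<Rightarrow> mpoly set" where
  "polynomials d = {p. \<forall>m \<in> Poly_Mapping.keys p. Poly_Mapping.keys m \<subseteq> {1..d}}"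

definition rational_functions :: "nat \<Rightarrow> rfun set" where
  "rational_functions d =
     {Fraction_Field.Fract p q | p q. p \<in> polynomials d \<and> q \<in> polynomials d \<and> q \<noteq> 0}"

definition const :: "real \<Rightarrow> rfun" where
  "const c = Fraction_Field.Fract (Poly_Mapping.single 0 c) 1"

definition var :: "nat \<Rightarrow> rfun" where
  "var j = Fraction_Field.Fract (Poly_Mapping.single (Poly_Mapping.single j 1) 1) 1"

definition pencil :: "nat \<Rightarrow> nat \<Rightarrow> (nat \<Rightarrow> real mat) \<Rightarrow> rfun mat" where
  "pencil d M A =
     mat M M (\<lambda>(i, k). const (A 0 $$ (i, k)) + (\<Sum>j = 1..d. var j * const (A j $$ (i, k))))"

end

theory Submission
  imports Defs
begin

text \<open>
  The functions of the form \<open>c\<^sup>T P\<^sup>-\<^sup>1 c\<close>, with \<open>P\<close> a nonsingular real symmetric affine pencil and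
  \<open>c\<close> a real vector, are the Schur complements of the bordered pencils with corner block \<open>0\<close>,
  border \<open>c\<close> and lower right block \<open>- P\<close>. They form a real vector space (take block
  diagonal pencils), and they are closed under inversion, because the corner entry of the inverse of
  a bordered matrix is the inverse of its Schur complement. Hua's identity
  \<open>1/f - 1/(f + 1) = 1/(f\<^sup>2 + f)\<close> and polarisation then make them a field. This field contains the
  inverses of the affine functions, hence all rational functions.
\<close>

section \<open>Affine rational functions\<close>

lemma const_0 [simp]: "const 0 = 0"
  and const_1 [simp]: "const 1 = 1"
  by (simp_all add: const_def Zero_fract_def One_fract_def)

lemma const_add: "const (a + b) = const a + const b"
  by (simp add: const_def single_add)

lemma const_mult: "const (a * b) = const a * const b"
  by (simp add: const_def mult_single)

lemma const_uminus: "const (- a) = - const a"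
  using const_add[of a "- a"] by (simp add: add_eq_0_iff)

text \<open>This is the shape of one entry of \<open>pencil\<close>, with \<open>a j\<close> in the
  place of an entry of \<open>A j\<close>.\<close>

definition affine_form :: "nat \<Rightarrow> (nat \<Rightarrow> real) \<Rightarrow> rfun" where
  "affine_form d a = const (a 0) + (\<Sum>j = 1..d. var j * const (a j))"

definition affine_functions :: "nat \<Rightarrow> rfun set" where
  "affine_functions d = range (affine_form d)"

lemma const_affine [simp, intro]: "const c \<in> affine_functions d"
proof -
  have "const c = affine_form d (\<lambda>j. if j = 0 then c else 0)"
    by (simp add: affine_form_def)
  then show ?thesis unfolding affine_functions_def by blast
qed

lemma zero_affine [simp, intro]: "0 \<in> affine_functions d"
  using const_affine[of 0] by simp

lemma var_affine [simp, intro]: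
  assumes "j \<in> {1..d}"
  shows "var j \<in> affine_functions d"
proof -
  have "var i * const (of_bool (i = j)) = (if i = j then var j else 0)" for i
    by simp
  then have "var j = affine_form d (\<lambda>i. of_bool (i = j))"
    using assms by (simp add: affine_form_def)
  then show ?thesis unfolding affine_functions_def by blast
qed

lemma const_mult_affine:
  assumes "l \<in> affine_functions d"
  shows "const r * l \<in> affine_functions d"
proof -
  obtain a where "l = affine_form d a"
    using assms unfolding affine_functions_def by blast
  then have "const r * l = affine_form d (\<lambda>j. r * a j)"
    by (simp add: affine_form_def const_mult distrib_left sum_distrib_left mult_ac)
  then show ?thesis unfolding affine_functions_def by blast
qed

lemma uminus_affine:
  assumes "l \<in> affine_functions d"
  shows "- l \<in> affine_functions d"
  using const_mult_affine[OF assms, of "- 1"] by (simp add: const_uminus)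

section \<open>Symmetric affine pencils and their borderings\<close>

text \<open>Affineness is asked entry by entry, so block constructions need not track coefficient
  matrices; \<open>affine_pencil_eq_pencil\<close> recovers these at the end.\<close>

definition affine_pencil :: "nat \<Rightarrow> nat \<Rightarrow> rfun mat \<Rightarrow> bool" where
  "affine_pencil d n P \<longleftrightarrow> P \<in> carrier_mat n n \<and> transpose_mat P = P \<and>
     (\<forall>i < n. \<forall>j < n. P $$ (i, j) \<in> affine_functions d)"

lemma affine_pencilI:
  assumes "P \<in> carrier_mat n n"
    and "\<And>i j. i < n \<Longrightarrow> j < n \<Longrightarrow> P $$ (j, i) = P $$ (i, j)"
    and "\<And>i j. i < n \<Longrightarrow> j < n \<Longrightarrow> P $$ (i, j) \<in> affine_functions d"
  shows "affine_pencil d n P"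
  using assms unfolding affine_pencil_def by (auto intro!: eq_matI)

lemma affine_pencilD:
  assumes "affine_pencil d n P"
  shows "P \<in> carrier_mat n n"
    and "\<And>i j. i < n \<Longrightarrow> j < n \<Longrightarrow> P $$ (j, i) = P $$ (i, j)"
    and "\<And>i j. i < n \<Longrightarrow> j < n \<Longrightarrow> P $$ (i, j) \<in> affine_functions d"
  using assms unfolding affine_pencil_def by (auto, metis carrier_matD index_transpose_mat(1))

lemma affine_pencil_eq_pencil:
  assumes "affine_pencil d n P"
  obtains A where "pencil d n A = P"
    and "\<And>j. A j \<in> carrier_mat n n" and "\<And>j. transpose_mat (A j) = A j"
proof -
  \<comment> \<open>The coefficients are chosen as a function of the value of an entry alone. Equal
    entries thus get equal coefficients, and every \<open>A j\<close> inherits the symmetry of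
    \<open>P\<close>.\<close>
  obtain a where a: "\<And>l. l \<in> affine_functions d \<Longrightarrow> affine_form d (a l) = l"
    using f_inv_into_f[of _ "affine_form d" UNIV] unfolding affine_functions_def by blast
  define A where "A j = mat n n (\<lambda>ij. a (P $$ ij) j)" for j
  note P = affine_pencilD[OF assms]
  show ?thesis
  proof
    show "pencil d n A = P"
      using P(1) a[OF P(3)] by (intro eq_matI) (auto simp: pencil_def A_def affine_form_def)
    show "A j \<in> carrier_mat n n" for j
      by (simp add: A_def)
    show "transpose_mat (A j) = A j" for j
      by (rule eq_matI) (auto simp: A_def P(2))
  qed
qed

text \<open>The minus sign in the lower right block makes the Schur complement
  \<open>c \<bullet> x\<close> instead of its negative, where
  \<open>P *\<^sub>v x = c\<close>.\<close>

definition bordered :: "'a :: comm_ring_1 vec \<Rightarrow> 'a mat \<Rightarrow> 'a mat" where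
  "bordered c P = four_block_mat (0\<^sub>m 1 1) (mat_of_rows (dim_vec c) [c])
     (mat_of_cols (dim_vec c) [c]) (- P)"

lemma affine_pencil_bordered:
  assumes P: "affine_pencil d n P" and c: "c \<in> carrier_vec n"
    and aff: "\<And>i. i < n \<Longrightarrow> c $ i \<in> affine_functions d"
  shows "affine_pencil d (Suc n) (bordered c P)"
proof -
  note P' = affine_pencilD[OF P]
  show ?thesis
  proof (rule affine_pencilI)
    show "bordered c P \<in> carrier_mat (Suc n) (Suc n)"
      using P'(1) c by (auto simp: bordered_def)
    fix i j assume ij: "i < Suc n" "j < Suc n"
    show "bordered c P $$ (j, i) = bordered c P $$ (i, j)"
      using P'(1,2) c ij
      by (cases i; cases j) (auto simp: bordered_def mat_of_rows_def mat_of_cols_def)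
    show "bordered c P $$ (i, j) \<in> affine_functions d"
      using P'(1,3) c aff ij
      by (cases i; cases j)
        (auto simp: bordered_def mat_of_rows_def mat_of_cols_def uminus_affine)
  qed
qed

text \<open>Splitting off the first coordinate \<open>t\<close> serves twice in
  \<open>realizable_inverse\<close>: to show that the kernel is trivial and to check an explicit
  solution.\<close>

lemma bordered_mult_vec:
  assumes P: "P \<in> carrier_mat n n" and c: "c \<in> carrier_vec n" and y: "y \<in> carrier_vec n"
  shows "bordered c P *\<^sub>v (vec 1 (\<lambda>_. t) @\<^sub>v y) = vec 1 (\<lambda>_. c \<bullet> y) @\<^sub>v (t \<cdot>\<^sub>v c - P *\<^sub>v y)"
proof -
  have "bordered c P *\<^sub>v (vec 1 (\<lambda>_. t) @\<^sub>v y) =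
    (0\<^sub>m 1 1 *\<^sub>v vec 1 (\<lambda>_. t) + mat_of_rows n [c] *\<^sub>v y) @\<^sub>v
    (mat_of_cols n [c] *\<^sub>v vec 1 (\<lambda>_. t) + (- P) *\<^sub>v y)"
    unfolding bordered_def using assms
    by (subst four_block_mat_mult_vec[of _ 1 1 _ n _ n]) auto
  also have "0\<^sub>m 1 1 *\<^sub>v vec 1 (\<lambda>_. t) + mat_of_rows n [c] *\<^sub>v y = vec 1 (\<lambda>_. c \<bullet> y)"
    using assms by (intro eq_vecI) (auto simp: scalar_prod_def mat_of_rows_def)
  also have "mat_of_cols n [c] *\<^sub>v vec 1 (\<lambda>_. t) + (- P) *\<^sub>v y = t \<cdot>\<^sub>v c - P *\<^sub>v y"
    using assms by (intro eq_vecI) (auto simp: scalar_prod_def mat_of_cols_def sum_negf)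
  finally show ?thesis .
qed

lemma nonsingular_mult_vec_inj:
  fixes P :: "'a :: idom mat"
  assumes P: "P \<in> carrier_mat n n" "det P \<noteq> 0"
    and y: "y \<in> carrier_vec n" and z: "z \<in> carrier_vec n"
    and eq: "P *\<^sub>v y = P *\<^sub>v z"
  shows "y = z"
proof -
  have "P *\<^sub>v (y - z) = 0\<^sub>v n"
    using P y z eq by (simp add: mult_minus_distrib_mat_vec)
  then have "y - z = 0\<^sub>v n"
    using det_0_iff_vec_prod_zero[OF P(1)] P(2) minus_carrier_vec[OF y z] by blast
  then have "(y - z) $ i = 0" if "i < n" for i
    using that by simp
  then show ?thesis
    using y z by (intro eq_vecI) auto
qed

section \<open>The field of realizable functions\<close>

text \<open>The vector \<open>x\<close> stands for \<open>P\<^sup>-\<^sup>1 c\<close>.\<close>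

definition realizes :: "nat \<Rightarrow> nat \<Rightarrow> rfun mat \<Rightarrow> rfun vec \<Rightarrow> rfun vec \<Rightarrow> rfun \<Rightarrow> bool" where
  "realizes d n P c x f \<longleftrightarrow> affine_pencil d n P \<and> det P \<noteq> 0 \<and>
     c \<in> carrier_vec n \<and> (\<forall>i < n. c $ i \<in> range const) \<and>
     x \<in> carrier_vec n \<and> P *\<^sub>v x = c \<and> f = c \<bullet> x"

definition realizable :: "nat \<Rightarrow> rfun set" where
  "realizable d = {f. \<exists>n P c x. realizes d n P c x f}"

text \<open>The direct sum of the two pencils, with the vectors concatenated, adds the two scalar
  products.\<close>

lemma realizable_add:
  assumes "f \<in> realizable d" "g \<in> realizable d"
  shows "f + g \<in> realizable d"
proof -
  obtain n P c x where f: "realizes d n P c x f"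
    using assms(1) unfolding realizable_def by blast
  obtain m Q b y where g: "realizes d m Q b y g"
    using assms(2) unfolding realizable_def by blast
  have "affine_pencil d n P" "affine_pencil d m Q"
    using f g unfolding realizes_def by auto
  note P = affine_pencilD[OF this(1)] and Q = affine_pencilD[OF this(2)]
  let ?R = "four_block_mat P (0\<^sub>m n m) (0\<^sub>m m n) Q"
  have "affine_pencil d (n + m) ?R"
    using P Q by (intro affine_pencilI) auto
  moreover have "det ?R \<noteq> 0"
    using f g P(1) Q(1) unfolding realizes_def
    by (subst det_four_block_mat_lower_left_zero[of _ n _ m]) auto
  moreover have "?R *\<^sub>v (x @\<^sub>v y) = c @\<^sub>v b"
    using f g P(1) Q(1) unfolding realizes_def by (subst mult_mat_vec_split) auto
  moreover have "f + g = (c @\<^sub>v b) \<bullet> (x @\<^sub>v y)"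
    using f g unfolding realizes_def by (subst scalar_prod_append[of _ n _ m]) auto
  moreover have "(c @\<^sub>v b) $ i \<in> range const" if "i < n + m" for i
  proof -
    have "c \<in> carrier_vec n" "b \<in> carrier_vec m"
      "\<forall>i < n. c $ i \<in> range const" "\<forall>i < m. b $ i \<in> range const"
      using f g unfolding realizes_def by auto
    then show ?thesis using that by auto
  qed
  ultimately have "realizes d (n + m) ?R (c @\<^sub>v b) (x @\<^sub>v y) (f + g)"
    using f g unfolding realizes_def by auto
  then show ?thesis unfolding realizable_def by blast
qed

lemma realizable_0: "0 \<in> realizable d"
proof -
  \<comment> \<open>The empty pencil has determinant 1, and the scalar product is an empty
    sum.\<close>
  have "realizes d 0 (1\<^sub>m 0) (0\<^sub>v 0) (0\<^sub>v 0) 0"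
    by (auto simp: realizes_def affine_pencil_def)
  then show ?thesis unfolding realizable_def by blast
qed

text \<open>Dividing \<open>P\<close> by \<open>r\<close> and keeping \<open>c\<close> multiplies
  the solution \<open>x\<close> by \<open>r\<close>. This works for either sign of \<open>r\<close>,
  whereas scaling \<open>c\<close> would multiply \<open>f\<close> by a square.\<close>

lemma realizable_scale:
  assumes "f \<in> realizable d"
  shows "const r * f \<in> realizable d"
proof (cases "r = 0")
  case False
  obtain n P c x where f: "realizes d n P c x f"
    using assms unfolding realizable_def by blast
  have "affine_pencil d n P" and x: "x \<in> carrier_vec n"
    using f unfolding realizes_def by auto
  note P = affine_pencilD[OF this(1)]
  let ?s = "const (inverse r)" and ?r = "const r"
  have rs: "?s * ?r = 1"
    using False by (simp flip: const_mult)
  then have s: "?s \<noteq> 0" by auto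
  have "affine_pencil d n (?s \<cdot>\<^sub>m P)"
    using P by (intro affine_pencilI) (auto simp: const_mult_affine)
  moreover have "det (?s \<cdot>\<^sub>m P) \<noteq> 0"
    using f s unfolding realizes_def by auto
  moreover have "(?s \<cdot>\<^sub>m P) *\<^sub>v (?r \<cdot>\<^sub>v x) = P *\<^sub>v x"
    using P(1) x rs by (intro eq_vecI) (auto simp: mult_mat_vec mult_ac)
  ultimately have "realizes d n (?s \<cdot>\<^sub>m P) c (?r \<cdot>\<^sub>v x) (?r * f)"
    using f unfolding realizes_def by auto
  then show ?thesis unfolding realizable_def by blast
qed (simp add: realizable_0)

lemma realizable_diff:
  assumes "f \<in> realizable d" "g \<in> realizable d"
  shows "f - g \<in> realizable d"
  using realizable_add[OF assms(1) realizable_scale[OF assms(2), of "- 1"]]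
  by (simp add: const_uminus)

text \<open>The corner entry of the inverse of \<open>bordered c P\<close> is
  \<open>inverse f\<close>, so that matrix with the first unit vector realizes
  \<open>inverse f\<close>. For \<open>f = 0\<close> the convention \<open>inverse 0 = 0\<close>
  applies.\<close>

lemma realizable_inverse:
  assumes "f \<in> realizable d"
  shows "inverse f \<in> realizable d"
proof (cases "f = 0")
  case False
  obtain n P c x where f: "realizes d n P c x f"
    using assms unfolding realizable_def by blast
  have P: "affine_pencil d n P" "P \<in> carrier_mat n n" "det P \<noteq> 0"
    and c: "c \<in> carrier_vec n" "\<And>i. i < n \<Longrightarrow> c $ i \<in> affine_functions d"
    and x: "x \<in> carrier_vec n" "P *\<^sub>v x = c" and fx: "f = c \<bullet> x"
    using f unfolding realizes_def affine_pencil_def by auto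
  \<comment> \<open>\<open>?z\<close> is the first column of the inverse of \<open>?B\<close>: its
    first row gives \<open>c \<bullet> x / f = 1\<close>, the others give
    \<open>c / f - P x / f = 0\<close>.\<close>
  let ?B = "bordered c P" and ?e = "vec 1 (\<lambda>_. 1) @\<^sub>v 0\<^sub>v n"
    and ?z = "vec 1 (\<lambda>_. inverse f) @\<^sub>v (inverse f \<cdot>\<^sub>v x)"
  have B: "affine_pencil d (Suc n) ?B"
    using affine_pencil_bordered[OF P(1) c] .
  then have Bc: "?B \<in> carrier_mat (Suc n) (Suc n)"
    unfolding affine_pencil_def by blast
  \<comment> \<open>A kernel vector \<open>(t, y)\<close> satisfies
    \<open>P y = t c = P (t x)\<close>, so \<open>y = t x\<close>; then
    \<open>0 = c \<bullet> y = t f\<close> forces \<open>t = 0\<close>.\<close>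
  have "v = 0\<^sub>v (Suc n)" if v: "v \<in> carrier_vec (Suc n)" and Bv: "?B *\<^sub>v v = 0\<^sub>v (Suc n)" for v
  proof -
    define t y where "t = v $ 0" and "y = vec n (\<lambda>i. v $ Suc i)"
    have y: "y \<in> carrier_vec n" by (simp add: y_def)
    have v_eq: "v = vec 1 (\<lambda>_. t) @\<^sub>v y"
      using v by (intro eq_vecI) (auto simp: t_def y_def)
    have eq: "vec 1 (\<lambda>_. c \<bullet> y) @\<^sub>v (t \<cdot>\<^sub>v c - P *\<^sub>v y) = 0\<^sub>v (Suc n)"
      using Bv unfolding v_eq bordered_mult_vec[OF P(2) c(1) y] .
    have cy: "c \<bullet> y = 0"
      using arg_cong[OF eq, of "\<lambda>v. v $ 0"] by simp
    have "(t \<cdot>\<^sub>v c) $ i = (P *\<^sub>v y) $ i" if "i < n" for i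
      using arg_cong[OF eq, of "\<lambda>v. v $ Suc i"] that P(2) c(1) y by auto
    then have "P *\<^sub>v y = P *\<^sub>v (t \<cdot>\<^sub>v x)"
      using P(2) c(1) x y by (intro eq_vecI) (auto simp: mult_mat_vec)
    then have ytx: "y = t \<cdot>\<^sub>v x"
      using nonsingular_mult_vec_inj[OF P(2,3)] x y by simp
    then have "t * f = 0"
      using cy c(1) x fx by simp
    then have "t = 0" using False by simp
    then show ?thesis
      using x unfolding v_eq ytx by (intro eq_vecI) auto
  qed
  then have "det ?B \<noteq> 0"
    using det_0_iff_vec_prod_zero[OF Bc] by blast
  moreover have "?B *\<^sub>v ?z = ?e"
    using P c x fx False
    by (subst bordered_mult_vec[where n = n]) (auto simp: mult_mat_vec)
  moreover have "inverse f = ?e \<bullet> ?z"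
    using x by (subst scalar_prod_append[of _ 1 _ n]) (auto simp: scalar_prod_def)
  moreover have "\<forall>i < Suc n. ?e $ i \<in> range const"
    using rangeI[of const 0] rangeI[of const 1] by simp
  moreover have "?e \<in> carrier_vec (Suc n)" "?z \<in> carrier_vec (Suc n)"
    using x(1) by (intro carrier_vecI; simp)+
  ultimately have "realizes d (Suc n) ?B ?e ?z (inverse f)"
    using B unfolding realizes_def by (intro conjI)
  then show ?thesis unfolding realizable_def by blast
qed (simp add: realizable_0)

text \<open>For nonzero \<open>l\<close> the 1 by 1 pencil with entry \<open>l\<close> realizes
  \<open>inverse l\<close>; a second inversion returns \<open>l\<close>.\<close>

lemma realizable_affine:
  assumes "l \<in> affine_functions d"
  shows "l \<in> realizable d"
proof (cases "l = 0")
  case False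
  have "realizes d 1 (mat 1 1 (\<lambda>_. l)) (vec 1 (\<lambda>_. 1)) (vec 1 (\<lambda>_. inverse l)) (inverse l)"
    using assms False rangeI[of const 1]
    by (auto simp: realizes_def affine_pencil_def det_single scalar_prod_def intro!: eq_matI eq_vecI)
  then have "inverse l \<in> realizable d"
    unfolding realizable_def by blast
  from realizable_inverse[OF this] show ?thesis by simp
qed (simp add: realizable_0)

lemma realizable_const: "const c \<in> realizable d"
  by (simp add: realizable_affine)

lemma realizable_1: "1 \<in> realizable d"
  using realizable_const[of 1] by simp

text \<open>Inverting the difference in Hua's identity gives \<open>f * f + f\<close>, from which
  \<open>f\<close> is subtracted. The values 0 and -1 of \<open>f\<close>, where a denominator
  vanishes, have the squares 0 and 1.\<close>

lemma realizable_square: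
  assumes "f \<in> realizable d"
  shows "f * f \<in> realizable d"
proof (cases "f = 0 \<or> f + 1 = 0")
  case True
  then have "f * f = 0 \<or> f * f = 1"
    by (auto simp: eq_neg_iff_add_eq_0[symmetric])
  then show ?thesis using realizable_0 realizable_1 by metis
next
  case False
  have "inverse (inverse f - inverse (f + 1)) - f \<in> realizable d"
    using assms by (intro realizable_diff realizable_inverse realizable_add realizable_1)
  also have "inverse f - inverse (f + 1) = inverse (f * (f + 1))"
    using False by (simp add: field_simps)
  finally show ?thesis by (simp add: algebra_simps)
qed

text \<open>Polarisation: four times the product is the difference of the squares of
  \<open>f + g\<close> and \<open>f - g\<close>.\<close>

lemma realizable_mult:
  assumes "f \<in> realizable d" "g \<in> realizable d"
  shows "f * g \<in> realizable d"
proof -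
  have "const (inverse 4) * ((f + g) * (f + g) - (f - g) * (f - g)) \<in> realizable d"
    using assms
    by (intro realizable_scale realizable_diff realizable_square realizable_add)
  also have "(f + g) * (f + g) - (f - g) * (f - g) = (1 + 1 + 1 + 1) * (f * g)"
    by (simp add: algebra_simps)
  also have "1 + 1 + 1 + 1 = const 4"
    by (simp flip: const_add const_1)
  finally show ?thesis
    by (simp flip: const_mult mult.assoc)
qed

section \<open>Rational functions are realizable\<close>

lemma realizable_power:
  assumes "f \<in> realizable d"
  shows "f ^ k \<in> realizable d"
  by (induction k) (auto intro: assms realizable_1 realizable_mult)

lemma to_fract_single_power: "to_fract (Poly_Mapping.single (Poly_Mapping.single j k) 1) = var j ^ k"
proof (induction k)
  case (Suc k)
  have "Poly_Mapping.single (Poly_Mapping.single j (Suc k)) (1::real) =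
      Poly_Mapping.single (Poly_Mapping.single j 1) 1 * Poly_Mapping.single (Poly_Mapping.single j k) 1"
    by (simp add: mult_single flip: single_add)
  then have "to_fract (Poly_Mapping.single (Poly_Mapping.single j (Suc k)) (1::real)) =
      var j * to_fract (Poly_Mapping.single (Poly_Mapping.single j k) 1)"
    by (simp add: var_def to_fract_def)
  then show ?case
    by (simp only: Suc power_Suc)
qed (simp add: to_fract_def One_fract_def)

text \<open>Applied at two levels: to a monomial, whose keys are variable indices and whose values
  are exponents, and to a polynomial, whose keys are monomials. The set \<open>K\<close> carries the
  restriction to the first \<open>d\<close> variables.\<close>

lemma poly_mapping_keys_induct [consumes 1, case_names zero add]:
  fixes p :: "'a \<Rightarrow>\<^sub>0 'b :: cancel_comm_monoid_add"
  assumes "Poly_Mapping.keys p \<subseteq> K"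
    and "P 0"
    and "\<And>k v p. k \<in> K \<Longrightarrow> P p \<Longrightarrow> P (Poly_Mapping.single k v + p)"
  shows "P p"
proof -
  have "P p" if "finite F" "Poly_Mapping.keys p = F" "F \<subseteq> K" for F and p :: "'a \<Rightarrow>\<^sub>0 'b"
    using that
  proof (induction F arbitrary: p rule: finite_induct)
    case empty
    then show ?case using assms(2) by simp
  next
    case (insert k F)
    \<comment> \<open>Setting the value at \<open>k\<close> to 0 removes \<open>k\<close> from the
      support.\<close>
    let ?q = "Poly_Mapping.update k 0 p"
    have "Poly_Mapping.keys ?q = F"
      using insert.hyps insert.prems(1) by (simp add: keys_update)
    then have "P (Poly_Mapping.single k (Poly_Mapping.lookup p k) + ?q)"
      using insert.prems by (intro assms(3) insert.IH) auto
    also have "Poly_Mapping.single k (Poly_Mapping.lookup p k) + ?q = p"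
      by (rule poly_mapping_eqI) (auto simp: lookup_add lookup_single lookup_update when_def)
    finally show ?case .
  qed
  from this[OF finite_keys refl assms(1)] show ?thesis .
qed

lemma realizable_monomial:
  assumes "Poly_Mapping.keys m \<subseteq> {1..d}"
  shows "to_fract (Poly_Mapping.single m 1) \<in> realizable d"
  using assms
proof (induction m rule: poly_mapping_keys_induct)
  case zero
  then show ?case using realizable_1 by (simp add: to_fract_def One_fract_def)
next
  case (add j k m)
  have "Poly_Mapping.single (Poly_Mapping.single j k + m) (1::real) =
      Poly_Mapping.single (Poly_Mapping.single j k) 1 * Poly_Mapping.single m 1"
    by (simp add: mult_single)
  then have "to_fract (Poly_Mapping.single (Poly_Mapping.single j k + m) 1) =
      var j ^ k * to_fract (Poly_Mapping.single m 1)"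
    by (simp add: to_fract_single_power)
  then show ?case
    using add by (metis realizable_mult realizable_power realizable_affine var_affine)
qed

lemma realizable_polynomial:
  assumes "p \<in> polynomials d"
  shows "to_fract p \<in> realizable d"
proof -
  have "Poly_Mapping.keys p \<subseteq> {m. Poly_Mapping.keys m \<subseteq> {1..d}}"
    using assms by (simp add: polynomials_def subset_iff)
  then show ?thesis
  proof (induction p rule: poly_mapping_keys_induct)
    case zero
    then show ?case by (simp add: realizable_0)
  next
    case (add m c p)
    have "to_fract (Poly_Mapping.single m c) = const c * to_fract (Poly_Mapping.single m 1)"
      by (simp add: const_def to_fract_def mult_single)
    then show ?case
      using add by (auto intro!: realizable_add realizable_scale realizable_monomial)
  qed
qed

lemma realizable_rational_function:
  assumes "f \<in> rational_functions d"
  shows "f \<in> realizable d"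
proof -
  obtain p q where pq: "p \<in> polynomials d" "q \<in> polynomials d"
    and "f = Fraction_Field.Fract p q"
    using assms unfolding rational_functions_def by blast
  then have "f = to_fract p * inverse (to_fract q)"
    by (simp add: to_fract_def)
  then show ?thesis
    using pq by (simp add: realizable_mult realizable_inverse realizable_polynomial)
qed

section \<open>The Schur complement\<close>

text \<open>A nonzero determinant makes the matrix a unit, which excludes the result
  \<open>None\<close>, so \<open>the\<close> yields a genuine inverse.\<close>

lemma mat_inverse_nonsingular:
  fixes A :: "'a :: field mat"
  assumes A: "A \<in> carrier_mat n n" and "det A \<noteq> 0"
  shows "the (mat_inverse A) \<in> carrier_mat n n" and "the (mat_inverse A) * A = 1\<^sub>m n"
proof -
  have "A \<in> Units (ring_mat TYPE('a) n ())"
    by (rule det_non_zero_imp_unit[OF assms])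
  then obtain B where "mat_inverse A = Some B"
    using mat_inverse(1)[OF A, of "()"] by (cases "mat_inverse A") auto
  then show "the (mat_inverse A) \<in> carrier_mat n n" and "the (mat_inverse A) * A = 1\<^sub>m n"
    using mat_inverse(2)[OF A] by auto
qed

lemma split_block_four_block_mat:
  assumes "A \<in> carrier_mat n1 m1" "B \<in> carrier_mat n1 m2" "C \<in> carrier_mat n2 m1" "D \<in> carrier_mat n2 m2"
  shows "split_block (four_block_mat A B C D) n1 m1 = (A, B, C, D)"
  using assms unfolding split_block_def Let_def
  by (simp, intro conjI eq_matI) simp_all

theorem corollary2p1:
  fixes d :: nat and f :: rfun
  assumes "f \<in> rational_functions d"
  shows "\<exists>(M :: nat) (A :: nat \<Rightarrow> real mat).
           M > 0 \<and>
           (\<forall>j \<le> d. A j \<in> carrier_mat M M \<and> transpose_mat (A j) = A j) \<and>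
           (case split_block (pencil d M A) 1 1 of (A11, A12, A21, A22) \<Rightarrow>
              det A22 \<noteq> 0 \<and>
              f = (A11 - A12 * the (mat_inverse A22) * A21) $$ (0, 0))"
proof -
  obtain n P c x where f: "realizes d n P c x f"
    using realizable_rational_function[OF assms] unfolding realizable_def by blast
  have P: "affine_pencil d n P" "P \<in> carrier_mat n n" "det P \<noteq> 0"
    and c: "c \<in> carrier_vec n" "\<And>i. i < n \<Longrightarrow> c $ i \<in> affine_functions d"
    and x: "x \<in> carrier_vec n" "P *\<^sub>v x = c" and fx: "f = c \<bullet> x"
    using f unfolding realizes_def affine_pencil_def by auto
  \<comment> \<open>The witness is the bordered pencil of size \<open>Suc n\<close>, which is
    positive even when \<open>n = 0\<close>.\<close>
  obtain A where A: "pencil d (Suc n) A = bordered c P"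
    "\<And>j. A j \<in> carrier_mat (Suc n) (Suc n)" "\<And>j. transpose_mat (A j) = A j"
    using affine_pencil_eq_pencil[OF affine_pencil_bordered[OF P(1) c]] by blast
  let ?r = "mat_of_rows n [c]" and ?c = "mat_of_cols n [c]" and ?Q = "the (mat_inverse (- P))"
  have split: "split_block (pencil d (Suc n) A) 1 1 = (0\<^sub>m 1 1, ?r, ?c, - P)"
    unfolding A(1) bordered_def using P(2) c(1)
    by (subst split_block_four_block_mat[of _ 1 1 _ n _ n]) auto
  have "- P = (- 1) \<cdot>\<^sub>m P"
    by (rule eq_matI) auto
  then have det: "det (- P) \<noteq> 0"
    using P(3) by simp
  have Q: "?Q \<in> carrier_mat n n" "?Q * (- P) = 1\<^sub>m n"
    using mat_inverse_nonsingular[OF _ det, of n] P(2) by auto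
  \<comment> \<open>Hence the inverse of \<open>- P\<close> sends \<open>c\<close> to
    \<open>- x\<close>. The product of the three blocks is then \<open>- f\<close>, and subtracting
    it from the zero corner leaves \<open>f\<close>.\<close>
  have "(- P) *\<^sub>v (- x) = c"
    using P(2) x(1) by (intro eq_vecI) (auto simp: scalar_prod_def sum_negf simp flip: x(2))
  moreover have "?Q *\<^sub>v ((- P) *\<^sub>v (- x)) = (?Q * (- P)) *\<^sub>v (- x)"
    using Q(1) P(2) x(1) by (intro assoc_mult_mat_vec[symmetric]) auto
  ultimately have Qc: "?Q *\<^sub>v c = - x"
    using Q(2) x(1) by simp
  have "?r * ?Q * ?c = ?r * (?Q * ?c)"
    using Q(1) by (intro assoc_mult_mat[of _ 1 n _ n _ 1]) auto
  moreover have "col (?Q * ?c) 0 = ?Q *\<^sub>v c"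
    using Q(1) c(1) by (subst col_mult2[of _ n n _ 1]) auto
  then have "(?r * (?Q * ?c)) $$ (0, 0) = c \<bullet> (?Q *\<^sub>v c)"
    using Q(1) c(1) by simp
  moreover have "c \<bullet> (?Q *\<^sub>v c) = - f"
    using Qc fx c(1) x(1) by simp
  ultimately have "(0\<^sub>m 1 1 - ?r * ?Q * ?c) $$ (0, 0) = f"
    using Q(1) by simp
  then show ?thesis
    using A(2,3) split det by (intro exI[of _ "Suc n"] exI[of _ A]) simp
qed

end
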